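(* Let $X,Y$ be Polish metric spaces, $\mu$ a Borel probability measure on $X$, $\nu$ a Borel probability measure on $Y$, and $Z$ a set. Let $c^{(1)}:X\times Z\to\mathbb{R}$ and $c^{(2)}:Z\times Y\to\mathbb{R}$ be such that, for every $z\in Z$, $c^{(1)}(\cdot,z)$ is Borel and $\mu$-integrable and $c^{(2)}(z,\cdot)$ is Borel and $\nu$-integrable. Let $Z_m=\{z_1,\dots,z_m\}\subset Z$ be a set of $m$ points, and let $(\vec\mu,\vec\nu)\in\mathcal P_X^Y(\mu,\nu)$ be an optimal partition corresponding to $c^{Z_m}(\mu,\nu)$. For each $i\in\{1,\dots,m\}$ let $\zeta(i)\in Z$ be a minimizer of $$Z\ni\zeta\mapsto\int_Xc^{(1)}(x,\zeta)\,\mu_{z_i}(dx)+\int_Yc^{(2)}(\zeta,y)\,\nu_{z_i}(dy),$$ and let $Z_m^{new}:=\{\zeta(1),\dots,\zeta(m)\}$. Then $$c^{Z_m^{new}}(\mu,\nu)\le c^{Z_m}(\mu,\nu).$$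
   Context: For a nonempty finite set $W\subset Z$, $c^{W}(x,y):=\min_{z\in W}\left[c^{(1)}(x,z)+c^{(2)}(z,y)\right]$ and $c^{W}(\mu,\nu):=\min_{\pi\in\Pi_X^Y(\mu,\nu)}\int_{X\times Y}c^{W}\,d\pi$, where $\Pi_X^Y(\mu,\nu)$ is the set of Borel probability measures on $X\times Y$ with $X$-marginal $\mu$ and $Y$-marginal $\nu$. $\mathcal P_X^Y(\mu,\nu)$ is the set of pairs $(\vec\mu,\vec\nu)$ with $\vec\mu=(\mu_z)_{z\in Z_m}$ nonnegative Borel measures on $X$, $\vec\nu=(\nu_z)_{z\in Z_m}$ nonnegative Borel measures on $Y$, such that $\sum_{z}\mu_z=\mu$, $\sum_z\nu_z=\nu$ and $\mu_z(X)=\nu_z(Y)$ for every $z\in Z_m$. An optimal partition corresponding to $c^{Z_m}(\mu,\nu)$ is an element of $\mathcal P_X^Y(\mu,\nu)$ minimizing $$\sum_{z\in Z_m}\left[\int_Xc^{(1)}(x,z)\,\mu_z(dx)+\int_Yc^{(2)}(z,y)\,\nu_z(dy)\right]$$ over $\mathcal P_X^Y(\mu,\nu)$. *)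

theory Defs
  imports "HOL-Probability.Probability"
begin

definition min_cost ::
    "('x \<Rightarrow> 'z \<Rightarrow> real) \<Rightarrow> ('z \<Rightarrow> 'y \<Rightarrow> real) \<Rightarrow> 'z set \<Rightarrow> 'x \<Rightarrow> 'y \<Rightarrow> real" where
  "min_cost c1 c2 W x y = Min ((\<lambda>z. c1 x z + c2 z y) ` W)"

definition couplings ::
    "'x::polish_space measure \<Rightarrow> 'y::polish_space measure \<Rightarrow> ('x \<times> 'y) measure set" where
  "couplings \<mu> \<nu> = {\<pi>. prob_space \<pi> \<and> sets \<pi> = sets borel \<and>
     distr \<pi> borel fst = \<mu> \<and> distr \<pi> borel snd = \<nu>}"

text \<open>The minimum over couplings is written as the infimum, a total function that
  agrees with the minimum whenever the latter is attained (see the lemma below).\<close>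

definition transport_cost ::
    "('x::polish_space \<Rightarrow> 'z \<Rightarrow> real) \<Rightarrow> ('z \<Rightarrow> 'y::polish_space \<Rightarrow> real) \<Rightarrow> 'z set
      \<Rightarrow> 'x measure \<Rightarrow> 'y measure \<Rightarrow> real" where
  "transport_cost c1 c2 W \<mu> \<nu> =
     (INF \<pi>\<in>couplings \<mu> \<nu>. \<integral>p. min_cost c1 c2 W (fst p) (snd p) \<partial>\<pi>)"

lemma transport_cost_eq_minimum:
  assumes "is_arg_min (\<lambda>\<pi>. \<integral>p. min_cost c1 c2 W (fst p) (snd p) \<partial>\<pi>)
             (\<lambda>\<pi>. \<pi> \<in> couplings \<mu> \<nu>) \<pi>\<^sub>0"
  shows "transport_cost c1 c2 W \<mu> \<nu> = (\<integral>p. min_cost c1 c2 W (fst p) (snd p) \<partial>\<pi>\<^sub>0)"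
  unfolding transport_cost_def
  using assms by (intro cInf_eq_minimum) (auto simp: is_arg_min_linorder)

text \<open>The equality of measures \<open>\<Sum>z\<in>W. M z = \<mu>\<close> is stated on Borel sets, since measures
  carry no addition. The families \<open>M\<close> and \<open>N\<close> are unconstrained outside \<open>W\<close>.\<close>

definition partitions ::
    "'z set \<Rightarrow> 'x::polish_space measure \<Rightarrow> 'y::polish_space measure
      \<Rightarrow> (('z \<Rightarrow> 'x measure) \<times> ('z \<Rightarrow> 'y measure)) set" where
  "partitions W \<mu> \<nu> = {(M, N).
     (\<forall>z\<in>W. sets (M z) = sets borel \<and> sets (N z) = sets borel) \<and>
     (\<forall>A\<in>sets borel. (\<Sum>z\<in>W. emeasure (M z) A) = emeasure \<mu> A) \<and>
     (\<forall>B\<in>sets borel. (\<Sum>z\<in>W. emeasure (N z) B) = emeasure \<nu> B) \<and>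
     (\<forall>z\<in>W. emeasure (M z) UNIV = emeasure (N z) UNIV)}"

definition partition_cost ::
    "('x \<Rightarrow> 'z \<Rightarrow> real) \<Rightarrow> ('z \<Rightarrow> 'y \<Rightarrow> real) \<Rightarrow> 'z set
      \<Rightarrow> ('z \<Rightarrow> 'x measure) \<times> ('z \<Rightarrow> 'y measure) \<Rightarrow> real" where
  "partition_cost c1 c2 W = (\<lambda>(M, N).
     \<Sum>z\<in>W. (\<integral>x. c1 x z \<partial>M z) + (\<integral>y. c2 z y \<partial>N z))"

definition optimal_partition ::
    "('x::polish_space \<Rightarrow> 'z \<Rightarrow> real) \<Rightarrow> ('z \<Rightarrow> 'y::polish_space \<Rightarrow> real) \<Rightarrow> 'z set
      \<Rightarrow> 'x measure \<Rightarrow> 'y measure \<Rightarrow> ('z \<Rightarrow> 'x measure) \<times> ('z \<Rightarrow> 'y measure) \<Rightarrow> bool" where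
  "optimal_partition c1 c2 W \<mu> \<nu> P \<longleftrightarrow>
     is_arg_min (partition_cost c1 c2 W) (\<lambda>Q. Q \<in> partitions W \<mu> \<nu>) P"

end

theory Submission
  imports Defs
begin

text \<open>Cutting a coupling \<open>\<pi>\<close> of \<open>\<mu>\<close> and \<open>\<nu>\<close> along the cells where \<open>z\<close> attains the minimum in
  \<open>c\<^sup>W\<close> and projecting the pieces gives a partition whose cost is the \<open>\<pi>\<close>-integral of \<open>c\<^sup>W\<close>, so
  the cost of an optimal partition is at most \<open>c\<^sup>W(\<mu>, \<nu>)\<close>. Replacing each \<open>z\<^sub>i\<close> by \<open>\<zeta>(i)\<close> does not
  increase that cost. Conversely, gluing the normalised products of \<open>\<mu>\<^sub>z\<close> and \<open>\<nu>\<^sub>z\<close> gives a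
  coupling, and routing the piece of \<open>z\<^sub>i\<close> through \<open>\<zeta>(i)\<close> bounds the transport cost for the new
  points by the cost with the replaced points.\<close>

section \<open>Integration against sums of measures\<close>

text \<open>Induction over nonnegative measurable functions: the hypothesis on \<open>P\<close> is
  the indicator case, and both sides respect scaling, addition and increasing limits.\<close>

lemma nn_integral_sum_of_measures:
  fixes P :: "'a measure"
  assumes Q: "\<And>z. z \<in> W \<Longrightarrow> sets (Q z) = sets P"
    and P: "\<And>A. A \<in> sets P \<Longrightarrow> emeasure P A = (\<Sum>z\<in>W. emeasure (Q z) A)"
    and f: "f \<in> borel_measurable P"
  shows "(\<integral>\<^sup>+x. f x \<partial>P) = (\<Sum>z\<in>W. \<integral>\<^sup>+x. f x \<partial>Q z)"
proof -
  have meas: "g \<in> borel_measurable (Q z)" if "g \<in> borel_measurable P" "z \<in> W"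
    for g :: "'a \<Rightarrow> ennreal" and z
    using that measurable_cong_sets[OF Q[OF that(2)] refl] by blast
  show ?thesis
    using f
  proof (induction rule: borel_measurable_induct)
    case (cong f g)
    have "space (Q z) = space P" if "z \<in> W" for z
      using Q[OF that] by (rule sets_eq_imp_space_eq)
    then have "(\<integral>\<^sup>+x. f x \<partial>Q z) = (\<integral>\<^sup>+x. g x \<partial>Q z)" if "z \<in> W" for z
      using that cong(3) by (intro nn_integral_cong) auto
    moreover have "(\<integral>\<^sup>+x. f x \<partial>P) = (\<integral>\<^sup>+x. g x \<partial>P)"
      using cong(3) by (intro nn_integral_cong) auto
    ultimately show ?case using cong(4) by simp
  next
    case (set A)
    have "(\<integral>\<^sup>+x. indicator A x \<partial>Q z) = emeasure (Q z) A" if "z \<in> W" for z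
      using set Q[OF that] by simp
    then show ?case using P[OF set] set by simp
  next
    case (mult u c)
    have "(\<integral>\<^sup>+x. c * u x \<partial>Q z) = c * (\<integral>\<^sup>+x. u x \<partial>Q z)" if "z \<in> W" for z
      using meas[OF mult(2) that] by (rule nn_integral_cmult)
    then show ?case using mult by (simp add: nn_integral_cmult sum_distrib_left)
  next
    case (add u v)
    have "(\<integral>\<^sup>+x. v x + u x \<partial>Q z) = (\<integral>\<^sup>+x. v x \<partial>Q z) + (\<integral>\<^sup>+x. u x \<partial>Q z)"
      if "z \<in> W" for z
      using meas[OF \<open>v \<in> borel_measurable P\<close> that] meas[OF \<open>u \<in> borel_measurable P\<close> that]
      by (rule nn_integral_add)
    then show ?case
      using add.IH nn_integral_add[OF \<open>v \<in> borel_measurable P\<close> \<open>u \<in> borel_measurable P\<close>]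
      by (simp add: sum.distrib)
  next
    case (seq U)
    note Um = \<open>\<And>i. U i \<in> borel_measurable P\<close> and inc = \<open>incseq U\<close>
    have "(\<integral>\<^sup>+x. (SUP i. U i) x \<partial>P) = (SUP i. \<integral>\<^sup>+x. U i x \<partial>P)"
      using nn_integral_monotone_convergence_SUP[OF inc Um] by (simp add: image_comp)
    also have "\<dots> = (SUP i. \<Sum>z\<in>W. \<integral>\<^sup>+x. U i x \<partial>Q z)"
      using seq.IH by simp
    also have "\<dots> = (\<Sum>z\<in>W. SUP i. \<integral>\<^sup>+x. U i x \<partial>Q z)"
      using inc by (intro incseq_sumI2 ennreal_SUP_sum)
        (auto simp: incseq_def le_fun_def intro!: nn_integral_mono)
    also have "\<dots> = (\<Sum>z\<in>W. \<integral>\<^sup>+x. (SUP i. U i) x \<partial>Q z)"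
      using nn_integral_monotone_convergence_SUP[OF inc meas[OF Um]]
      by (intro sum.cong refl) (simp add: image_comp)
    finally show ?case .
  qed
qed

text \<open>Integrability means that the integral of the norm is finite, and a finite sum in
  \<open>ennreal\<close> is finite exactly when each summand is.\<close>

lemma integrable_sum_of_measures_iff:
  fixes f :: "'a \<Rightarrow> real"
  assumes "finite W"
    and Q: "\<And>z. z \<in> W \<Longrightarrow> sets (Q z) = sets P"
    and P: "\<And>A. A \<in> sets P \<Longrightarrow> emeasure P A = (\<Sum>z\<in>W. emeasure (Q z) A)"
    and f: "f \<in> borel_measurable P"
  shows "integrable P f \<longleftrightarrow> (\<forall>z\<in>W. integrable (Q z) f)"
proof -
  have "f \<in> borel_measurable (Q z)" if "z \<in> W" for z
    using f measurable_cong_sets[OF Q[OF that] refl] by blast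
  then show ?thesis
    using nn_integral_sum_of_measures[OF Q P, of "\<lambda>x. ennreal (norm (f x))"] f assms(1)
    by (simp add: integrable_iff_bounded)
qed

text \<open>Reduction to the nonnegative case through positive and negative parts; integrability
  keeps all terms finite, so \<open>enn2real\<close> commutes with the sum.\<close>

lemma integral_sum_of_measures:
  fixes f :: "'a \<Rightarrow> real"
  assumes "finite W"
    and Q: "\<And>z. z \<in> W \<Longrightarrow> sets (Q z) = sets P"
    and P: "\<And>A. A \<in> sets P \<Longrightarrow> emeasure P A = (\<Sum>z\<in>W. emeasure (Q z) A)"
    and f: "integrable P f"
  shows "(\<integral>x. f x \<partial>P) = (\<Sum>z\<in>W. \<integral>x. f x \<partial>Q z)"
proof -
  have Qf: "integrable (Q z) f" if "z \<in> W" for z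
    using integrable_sum_of_measures_iff[OF assms(1) Q P] f that by auto
  \<comment> \<open>\<open>ennreal\<close> truncates negative values to 0, so the two choices of
    \<open>g\<close> give the positive and the negative part of \<open>f\<close>.\<close>
  have enn: "enn2real (\<integral>\<^sup>+x. ennreal (g x) \<partial>P) = (\<Sum>z\<in>W. enn2real (\<integral>\<^sup>+x. ennreal (g x) \<partial>Q z))"
    if "g = f \<or> g = (\<lambda>x. - f x)" for g
  proof -
    have "(\<integral>\<^sup>+x. ennreal (g x) \<partial>Q z) < \<top>" if "z \<in> W" for z
      using Qf[OF that] \<open>g = f \<or> _\<close> by (auto elim!: integrableE simp: less_top)
    moreover have "(\<lambda>x. ennreal (g x)) \<in> borel_measurable P"
      using f that by auto
    ultimately show ?thesis
      using nn_integral_sum_of_measures[OF Q P, of "\<lambda>x. ennreal (g x)"]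
      by (simp add: enn2real_sum)
  qed
  show ?thesis
    using f Qf enn[of f] enn[of "\<lambda>x. - f x"]
    by (simp add: real_lebesgue_integral_def sum_subtractf)
qed

text \<open>Countable additivity reduces to exchanging the sum over \<open>W\<close> with a series
  of nonnegative terms. The measure obtained here later glues couplings of the pieces into one
  coupling.\<close>

lemma sum_of_measures_exists:
  fixes Q :: "'z \<Rightarrow> 'a measure"
  assumes Q: "\<And>z. z \<in> W \<Longrightarrow> sets (Q z) = sets P"
  shows "\<exists>R. sets R = sets P \<and> (\<forall>A\<in>sets P. emeasure R A = (\<Sum>z\<in>W. emeasure (Q z) A))"
proof -
  define R where "R = measure_of (space P) (sets P) (\<lambda>A. \<Sum>z\<in>W. emeasure (Q z) A)"
  have sets: "sets R = sets P" by (simp add: R_def)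
  have "emeasure R A = (\<Sum>z\<in>W. emeasure (Q z) A)" if "A \<in> sets P" for A
    unfolding R_def
  proof (rule emeasure_measure_of_sigma)
    show "countably_additive (sets P) (\<lambda>A. \<Sum>z\<in>W. emeasure (Q z) A)"
    proof (rule countably_additiveI)
      fix A :: "nat \<Rightarrow> 'a set"
      assume A: "range A \<subseteq> sets P" "disjoint_family A"
      have "(\<Sum>i. \<Sum>z\<in>W. emeasure (Q z) (A i)) = (\<Sum>z\<in>W. \<Sum>i. emeasure (Q z) (A i))"
        by (rule suminf_sum) simp
      also have "\<dots> = (\<Sum>z\<in>W. emeasure (Q z) (\<Union>i. A i))"
        using A Q by (intro sum.cong suminf_emeasure) auto
      finally show "(\<Sum>i. \<Sum>z\<in>W. emeasure (Q z) (A i)) = (\<Sum>z\<in>W. emeasure (Q z) (\<Union>i. A i))" .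
    qed
  qed (use that in \<open>auto simp: positive_def sets.sigma_algebra_axioms\<close>)
  with sets show ?thesis by blast
qed

section \<open>Projections and measures with prescribed marginals\<close>

lemma borel_projections:
  fixes \<pi> :: "('a::topological_space \<times> 'b::topological_space) measure"
  assumes "sets \<pi> = sets borel"
  shows "fst \<in> borel_measurable \<pi>" "snd \<in> borel_measurable \<pi>"
  unfolding measurable_cong_sets[OF assms refl]
  by (intro borel_measurable_continuous_onI continuous_intros)+

text \<open>The product measure divided by the common mass \<open>c\<close> works, since the strip
  \<open>S \<times> UNIV\<close> has product measure \<open>emeasure \<alpha> S * c\<close>.
  Arbitrary finite masses, including 0, are allowed because the pieces of a partition are not
  normalised.\<close>

lemma exists_measure_with_marginals:
  fixes \<alpha> :: "'x::second_countable_topology measure"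
    and \<beta> :: "'y::second_countable_topology measure"
  assumes "sets \<alpha> = sets borel" "sets \<beta> = sets borel"
    and "finite_measure \<alpha>" "finite_measure \<beta>"
    and mass: "emeasure \<alpha> UNIV = emeasure \<beta> UNIV"
  shows "\<exists>\<gamma>. sets \<gamma> = sets borel \<and> distr \<gamma> borel fst = \<alpha> \<and> distr \<gamma> borel snd = \<beta>"
proof -
  interpret A: finite_measure \<alpha> by fact
  interpret B: finite_measure \<beta> by fact
  define c where "c = emeasure \<alpha> UNIV"
  define \<gamma> where "\<gamma> = scale_measure (inverse c) (\<alpha> \<Otimes>\<^sub>M \<beta>)"
  have sp: "space \<alpha> = UNIV" "space \<beta> = UNIV"
    using assms(1,2)[THEN sets_eq_imp_space_eq] by auto
  have "sets (\<alpha> \<Otimes>\<^sub>M \<beta>) = sets ((borel :: 'x measure) \<Otimes>\<^sub>M (borel :: 'y measure))"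
    using assms(1,2) by (rule sets_pair_measure_cong)
  also have "\<dots> = sets (borel :: ('x \<times> 'y) measure)"
    by (simp only: borel_prod)
  finally have sets: "sets \<gamma> = sets borel" by (simp add: \<gamma>_def)
  have spg: "space \<gamma> = UNIV" using sets_eq_imp_space_eq[OF sets] by simp
  have cfin: "c < \<top>" using A.emeasure_finite[of UNIV] by (simp only: c_def top.not_eq_extremum)
  \<comment> \<open>If \<open>c = 0\<close>, then \<open>inverse c = \<top>\<close>, and the identity still holds because \<open>\<top> * 0 = 0\<close>.\<close>
  have cancel: "inverse c * (a * c) = a" "inverse c * (c * a) = a" if "a \<le> c" for a
  proof -
    have "inverse c * c = 1" if "c \<noteq> 0"
      using ennreal_divide_self[OF that] cfin by (simp add: divide_ennreal_def mult.commute)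
    then show "inverse c * (a * c) = a" "inverse c * (c * a) = a"
      using that by (cases "c = 0"; simp add: ac_simps; simp flip: mult.assoc)+
  qed
  have "distr \<gamma> borel fst = \<alpha>"
  proof (rule measure_eqI)
    fix S assume "S \<in> sets (distr \<gamma> borel fst)"
    then have S: "S \<in> sets borel" by simp
    have "emeasure (distr \<gamma> borel fst) S = emeasure \<gamma> (S \<times> UNIV)"
      using S by (subst emeasure_distr[OF borel_projections(1)[OF sets]])
        (auto simp: spg intro!: arg_cong[where f = "emeasure \<gamma>"])
    also have "\<dots> = inverse c * (emeasure \<alpha> S * c)"
      using S assms(1,2) mass B.emeasure_pair_measure_Times[of S \<alpha> UNIV]
      by (simp add: \<gamma>_def c_def)
    \<comment> \<open>Monotonicity supplies the bound that \<open>cancel\<close> asks for; if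
      \<open>c = 0\<close>, it forces \<open>emeasure \<alpha> S = 0\<close>.\<close>
    also have "\<dots> = emeasure \<alpha> S"
      using emeasure_mono[of S UNIV \<alpha>] assms(1)
      by (intro cancel) (simp add: c_def)
    finally show "emeasure (distr \<gamma> borel fst) S = emeasure \<alpha> S" .
  qed (use assms in simp)
  moreover have "distr \<gamma> borel snd = \<beta>"
  proof (rule measure_eqI)
    fix S assume "S \<in> sets (distr \<gamma> borel snd)"
    then have S: "S \<in> sets borel" by simp
    have "emeasure (distr \<gamma> borel snd) S = emeasure \<gamma> (UNIV \<times> S)"
      using S by (subst emeasure_distr[OF borel_projections(2)[OF sets]])
        (auto simp: spg intro!: arg_cong[where f = "emeasure \<gamma>"])
    also have "\<dots> = inverse c * (c * emeasure \<beta> S)"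
      using S assms(1,2) sp B.emeasure_pair_measure_Times[of UNIV \<alpha> S]
      by (simp add: \<gamma>_def c_def)
    also have "\<dots> = emeasure \<beta> S"
      using emeasure_mono[of S UNIV \<beta>] assms(2) by (intro cancel) (simp add: c_def mass)
    finally show "emeasure (distr \<gamma> borel snd) S = emeasure \<beta> S" .
  qed (use assms in simp)
  ultimately show ?thesis using sets by blast
qed

section \<open>Bounds for the pointwise minimum of the costs\<close>

lemma min_cost_le:
  assumes "finite W" "z \<in> W"
  shows "min_cost c1 c2 W x y \<le> c1 x z + c2 z y"
  using assms by (auto simp: min_cost_def)

lemma min_cost_attained:
  assumes "finite W" "W \<noteq> {}"
  obtains z where "z \<in> W" "min_cost c1 c2 W x y = c1 x z + c2 z y"
proof -
  have "min_cost c1 c2 W x y \<in> (\<lambda>z. c1 x z + c2 z y) ` W"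
    unfolding min_cost_def using assms by (intro Min_in) auto
  then show ?thesis using that by auto
qed

text \<open>The minimum is one of the terms, hence dominated by the sum of all of them. Each summand
  of this bound depends on one coordinate only, so its integral is determined by the
  marginals.\<close>

lemma abs_min_cost_le:
  assumes "finite W" "W \<noteq> {}"
  shows "\<bar>min_cost c1 c2 W x y\<bar> \<le> (\<Sum>z\<in>W. \<bar>c1 x z\<bar> + \<bar>c2 z y\<bar>)"
proof -
  obtain z where z: "z \<in> W" "min_cost c1 c2 W x y = c1 x z + c2 z y"
    by (rule min_cost_attained[OF assms])
  then have "\<bar>min_cost c1 c2 W x y\<bar> \<le> \<bar>c1 x z\<bar> + \<bar>c2 z y\<bar>" by simp
  also have "\<dots> \<le> (\<Sum>z\<in>W. \<bar>c1 x z\<bar> + \<bar>c2 z y\<bar>)"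
    using z assms by (intro member_le_sum[where f = "\<lambda>z. \<bar>c1 x z\<bar> + \<bar>c2 z y\<bar>"]) auto
  finally show ?thesis .
qed

section \<open>Costs integrated against couplings\<close>

text \<open>The finite sets of intermediate points stay outside the locale, so that its results
  apply to old and new points alike. Having the costs as parameters permits a second instance with
  their absolute values.\<close>

locale transport_problem =
  fixes \<mu> :: "'x::polish_space measure" and \<nu> :: "'y::polish_space measure"
    and Z :: "'z set"
    and c1 :: "'x \<Rightarrow> 'z \<Rightarrow> real" and c2 :: "'z \<Rightarrow> 'y \<Rightarrow> real"
  assumes prob_mu: "prob_space \<mu>" and sets_mu: "sets \<mu> = sets borel"
    and prob_nu: "prob_space \<nu>" and sets_nu: "sets \<nu> = sets borel"
    and c1_borel: "\<And>z. z \<in> Z \<Longrightarrow> (\<lambda>x. c1 x z) \<in> borel_measurable borel"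
    and c1_integrable: "\<And>z. z \<in> Z \<Longrightarrow> integrable \<mu> (\<lambda>x. c1 x z)"
    and c2_borel: "\<And>z. z \<in> Z \<Longrightarrow> (\<lambda>y. c2 z y) \<in> borel_measurable borel"
    and c2_integrable: "\<And>z. z \<in> Z \<Longrightarrow> integrable \<nu> (\<lambda>y. c2 z y)"
begin

text \<open>Change of variables along the projections: a function of one coordinate sees only the
  corresponding marginal.\<close>

lemma coupling_integrable:
  assumes "\<pi> \<in> couplings \<mu> \<nu>" "z \<in> Z"
  shows "integrable \<pi> (\<lambda>p. c1 (fst p) z)" "integrable \<pi> (\<lambda>p. c2 z (snd p))"
    and "(\<integral>p. c1 (fst p) z \<partial>\<pi>) = (\<integral>x. c1 x z \<partial>\<mu>)" "(\<integral>p. c2 z (snd p) \<partial>\<pi>) = (\<integral>y. c2 z y \<partial>\<nu>)"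
proof -
  from assms(1) have s: "sets \<pi> = sets borel"
    and d: "distr \<pi> borel fst = \<mu>" "distr \<pi> borel snd = \<nu>" by (auto simp: couplings_def)
  note m = borel_projections[OF s]
  show "integrable \<pi> (\<lambda>p. c1 (fst p) z)"
    using c1_integrable[OF assms(2)] integrable_distr[OF m(1)] unfolding d(1)[symmetric] by blast
  show "integrable \<pi> (\<lambda>p. c2 z (snd p))"
    using c2_integrable[OF assms(2)] integrable_distr[OF m(2)] unfolding d(2)[symmetric] by blast
  show "(\<integral>p. c1 (fst p) z \<partial>\<pi>) = (\<integral>x. c1 x z \<partial>\<mu>)"
    using integral_distr[OF m(1) c1_borel[OF assms(2)]] d by simp
  show "(\<integral>p. c2 z (snd p) \<partial>\<pi>) = (\<integral>y. c2 z y \<partial>\<nu>)"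
    using integral_distr[OF m(2) c2_borel[OF assms(2)]] d by simp
qed

lemma min_cost_borel:
  assumes "finite W" "W \<noteq> {}" "W \<subseteq> Z"
  shows "(\<lambda>p. min_cost c1 c2 W (fst p) (snd p)) \<in> borel_measurable borel"
  unfolding min_cost_def image_image
proof (rule borel_measurable_Min)
  fix z assume "z \<in> W"
  with assms have [measurable]: "(\<lambda>x. c1 x z) \<in> borel_measurable borel"
    "(\<lambda>y. c2 z y) \<in> borel_measurable borel"
    using c1_borel c2_borel by auto
  show "(\<lambda>p. c1 (fst p) z + c2 z (snd p)) \<in> borel_measurable borel"
    by (intro borel_measurable_add measurable_compose[OF _ \<open>(\<lambda>x. c1 x z) \<in> _\<close>]
        measurable_compose[OF _ \<open>(\<lambda>y. c2 z y) \<in> _\<close>] borel_projections) auto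
qed (use assms in auto)

text \<open>Domination by the sum of the absolute costs. The second bound does not involve
  \<open>\<pi>\<close>, so it bounds the integrals from below uniformly over all couplings.\<close>

lemma min_cost_integrable:
  assumes "finite W" "W \<noteq> {}" "W \<subseteq> Z" and \<pi>: "\<pi> \<in> couplings \<mu> \<nu>"
  shows "integrable \<pi> (\<lambda>p. min_cost c1 c2 W (fst p) (snd p))"
    and "\<bar>\<integral>p. min_cost c1 c2 W (fst p) (snd p) \<partial>\<pi>\<bar>
      \<le> (\<Sum>z\<in>W. (\<integral>x. \<bar>c1 x z\<bar> \<partial>\<mu>) + (\<integral>y. \<bar>c2 z y\<bar> \<partial>\<nu>))"
proof -
  let ?f = "\<lambda>p. min_cost c1 c2 W (fst p) (snd p)"
  let ?b = "\<lambda>p. \<Sum>z\<in>W. \<bar>c1 (fst p) z\<bar> + \<bar>c2 z (snd p)\<bar>"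
  have s: "sets \<pi> = sets borel" using \<pi> by (simp add: couplings_def)
  have abs: "integrable \<pi> (\<lambda>p. \<bar>c1 (fst p) z\<bar>)" "integrable \<pi> (\<lambda>p. \<bar>c2 z (snd p)\<bar>)"
    "(\<integral>p. \<bar>c1 (fst p) z\<bar> \<partial>\<pi>) = (\<integral>x. \<bar>c1 x z\<bar> \<partial>\<mu>)"
    "(\<integral>p. \<bar>c2 z (snd p)\<bar> \<partial>\<pi>) = (\<integral>y. \<bar>c2 z y\<bar> \<partial>\<nu>)" if "z \<in> W" for z
  proof -
    \<comment> \<open>The instance with absolute costs yields the values of their integrals as well,
      not only their integrability.\<close>
    interpret A: transport_problem \<mu> \<nu> Z "\<lambda>x z. \<bar>c1 x z\<bar>" "\<lambda>z y. \<bar>c2 z y\<bar>"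
      by (intro transport_problem.intro)
        (simp_all add: prob_mu sets_mu prob_nu sets_nu borel_measurable_abs
          c1_borel c1_integrable c2_borel c2_integrable)
    from that assms(3) have "z \<in> Z" by auto
    from A.coupling_integrable[OF \<pi> this]
    show "integrable \<pi> (\<lambda>p. \<bar>c1 (fst p) z\<bar>)" "integrable \<pi> (\<lambda>p. \<bar>c2 z (snd p)\<bar>)"
      "(\<integral>p. \<bar>c1 (fst p) z\<bar> \<partial>\<pi>) = (\<integral>x. \<bar>c1 x z\<bar> \<partial>\<mu>)"
      "(\<integral>p. \<bar>c2 z (snd p)\<bar> \<partial>\<pi>) = (\<integral>y. \<bar>c2 z y\<bar> \<partial>\<nu>)" by auto
  qed
  have b: "integrable \<pi> ?b"
    using abs by (intro Bochner_Integration.integrable_sum Bochner_Integration.integrable_add) auto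
  have le: "\<bar>?f p\<bar> \<le> ?b p" for p
    using assms(1,2) by (rule abs_min_cost_le)
  have meas: "?f \<in> borel_measurable \<pi>"
    using min_cost_borel[OF assms(1-3)] measurable_cong_sets[OF s refl] by blast
  show f: "integrable \<pi> ?f"
    using b meas
  proof (rule Bochner_Integration.integrable_bound)
    show "AE p in \<pi>. norm (?f p) \<le> norm (?b p)"
      using le by (intro AE_I2) (metis abs_ge_self order_trans real_norm_def)
  qed
  have "\<bar>\<integral>p. ?f p \<partial>\<pi>\<bar> \<le> (\<integral>p. \<bar>?f p\<bar> \<partial>\<pi>)" by (rule integral_abs_bound)
  also have "\<dots> \<le> (\<integral>p. ?b p \<partial>\<pi>)"
    using f b le by (intro integral_mono) auto
  also have "\<dots> = (\<Sum>z\<in>W. (\<integral>x. \<bar>c1 x z\<bar> \<partial>\<mu>) + (\<integral>y. \<bar>c2 z y\<bar> \<partial>\<nu>))"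
    using abs by simp
  finally show "\<bar>\<integral>p. ?f p \<partial>\<pi>\<bar> \<le> (\<Sum>z\<in>W. (\<integral>x. \<bar>c1 x z\<bar> \<partial>\<mu>) + (\<integral>y. \<bar>c2 z y\<bar> \<partial>\<nu>))" .
qed

text \<open>An infimum of reals is guaranteed to be a lower bound only for sets bounded below; the
  coupling-independent estimate ensures this.\<close>

lemma transport_cost_le_coupling:
  assumes "finite W" "W \<noteq> {}" "W \<subseteq> Z" and \<pi>: "\<pi> \<in> couplings \<mu> \<nu>"
  shows "transport_cost c1 c2 W \<mu> \<nu> \<le> (\<integral>p. min_cost c1 c2 W (fst p) (snd p) \<partial>\<pi>)"
  unfolding transport_cost_def
proof (rule cINF_lower[OF _ \<pi>])
  show "bdd_below ((\<lambda>\<pi>. \<integral>p. min_cost c1 c2 W (fst p) (snd p) \<partial>\<pi>) ` couplings \<mu> \<nu>)"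
  proof (rule bdd_belowI2)
    fix \<rho> assume "\<rho> \<in> couplings \<mu> \<nu>"
    from min_cost_integrable(2)[OF assms(1-3) this]
    show "- (\<Sum>z\<in>W. (\<integral>x. \<bar>c1 x z\<bar> \<partial>\<mu>) + (\<integral>y. \<bar>c2 z y\<bar> \<partial>\<nu>))
        \<le> (\<integral>p. min_cost c1 c2 W (fst p) (snd p) \<partial>\<rho>)"
      by linarith
  qed
qed

text \<open>An infimum over the empty set of reals carries no information, so bounding the transport
  cost from below requires a coupling. It is the case of common mass 1 of
  \<open>exists_measure_with_marginals\<close>.\<close>

lemma couplings_nonempty: "couplings \<mu> \<nu> \<noteq> {}"
proof -
  interpret A: prob_space \<mu> by (rule prob_mu)
  interpret B: prob_space \<nu> by (rule prob_nu)
  have "emeasure \<mu> UNIV = emeasure \<nu> UNIV"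
    using A.emeasure_space_1 B.emeasure_space_1
    unfolding sets_eq_imp_space_eq[OF sets_mu] sets_eq_imp_space_eq[OF sets_nu] space_borel
    by (simp only:)
  from exists_measure_with_marginals[OF sets_mu sets_nu A.finite_measure_axioms
      B.finite_measure_axioms this]
  obtain \<gamma> :: "('x \<times> 'y) measure" where \<gamma>: "sets \<gamma> = sets borel"
    "distr \<gamma> borel fst = \<mu>" "distr \<gamma> borel snd = \<nu>"
    by (elim exE conjE)
  moreover have "prob_space \<gamma>"
    using prob_space_distrD[OF borel_projections(1)[OF \<gamma>(1)]] \<gamma>(2) prob_mu by simp
  ultimately show ?thesis by (auto simp: couplings_def)
qed

section \<open>Pieces of a partition\<close>

text \<open>Integrability under a sum of measures passes to every summand. The point
  \<open>w\<close> is independent of \<open>z\<close> because the piece of \<open>z\<close> will be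
  routed through a different point.\<close>

lemma partition_integrable:
  assumes "finite W" and MN: "(M, N) \<in> partitions W \<mu> \<nu>" and "z \<in> W" "w \<in> Z"
  shows "integrable (M z) (\<lambda>x. c1 x w)" "integrable (N z) (\<lambda>y. c2 w y)"
proof -
  from MN have "\<And>z. z \<in> W \<Longrightarrow> sets (M z) = sets \<mu>" "\<And>z. z \<in> W \<Longrightarrow> sets (N z) = sets \<nu>"
    "\<And>A. A \<in> sets \<mu> \<Longrightarrow> emeasure \<mu> A = (\<Sum>z\<in>W. emeasure (M z) A)"
    "\<And>A. A \<in> sets \<nu> \<Longrightarrow> emeasure \<nu> A = (\<Sum>z\<in>W. emeasure (N z) A)"
    by (auto simp: partitions_def sets_mu sets_nu)
  note * = this
  show "integrable (M z) (\<lambda>x. c1 x w)"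
    using integrable_sum_of_measures_iff[OF assms(1) *(1,3)] c1_integrable[OF assms(4)] assms(3)
    by blast
  show "integrable (N z) (\<lambda>y. c2 w y)"
    using integrable_sum_of_measures_iff[OF assms(1) *(2,4)] c2_integrable[OF assms(4)] assms(3)
    by blast
qed

text \<open>\<open>M z\<close> is dominated by the probability measure \<open>\<mu>\<close>, and the
  equality of masses transfers finiteness to \<open>N z\<close>.\<close>

lemma partition_finite_measure:
  assumes "finite W" and MN: "(M, N) \<in> partitions W \<mu> \<nu>" and "z \<in> W"
  shows "finite_measure (M z)" "finite_measure (N z)"
proof -
  interpret A: prob_space \<mu> by (rule prob_mu)
  have s: "sets (M z) = sets borel" "sets (N z) = sets borel"
    and eq: "emeasure (M z) UNIV = emeasure (N z) UNIV"
    using MN assms(3) by (auto simp: partitions_def)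
  have "emeasure (M z) UNIV \<le> (\<Sum>z\<in>W. emeasure (M z) UNIV)"
    using assms(1,3) by (intro member_le_sum[where f = "\<lambda>z. emeasure (M z) UNIV"]) auto
  also have "\<dots> = emeasure \<mu> UNIV"
  proof -
    have "\<forall>A\<in>sets borel. (\<Sum>z\<in>W. emeasure (M z) A) = emeasure \<mu> A"
      using MN by (simp add: partitions_def)
    then show ?thesis by simp
  qed
  finally have "emeasure (M z) UNIV \<noteq> \<infinity>"
    using A.emeasure_finite[of UNIV] by (auto simp: top_unique)
  then show "finite_measure (M z)" "finite_measure (N z)"
    using eq s[THEN sets_eq_imp_space_eq] by (auto intro!: finite_measureI)
qed

section \<open>From partitions to couplings and back\<close>

text \<open>The map \<open>h\<close> reroutes the piece of \<open>z\<close> through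
  \<open>h z\<close> and may merge points. Couplings \<open>Q z\<close> of \<open>M z\<close> and
  \<open>N z\<close> add up to a coupling of \<open>\<mu>\<close> and \<open>\<nu>\<close>, whose
  cost is estimated piece by piece.\<close>

lemma transport_cost_le_partition:
  assumes W: "finite W" "W \<noteq> {}" and MN: "(M, N) \<in> partitions W \<mu> \<nu>" and h: "h ` W \<subseteq> Z"
  shows "transport_cost c1 c2 (h ` W) \<mu> \<nu>
    \<le> (\<Sum>z\<in>W. (\<integral>x. c1 x (h z) \<partial>M z) + (\<integral>y. c2 (h z) y \<partial>N z))"
proof -
  let ?f = "\<lambda>p. min_cost c1 c2 (h ` W) (fst p) (snd p)"
  have "\<exists>\<gamma>. sets \<gamma> = sets borel \<and> distr \<gamma> borel fst = M z \<and> distr \<gamma> borel snd = N z"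
    if "z \<in> W" for z
    using MN that partition_finite_measure[OF W(1) MN that]
    by (intro exists_measure_with_marginals) (auto simp: partitions_def)
  then obtain Q where Q: "\<And>z. z \<in> W \<Longrightarrow> sets (Q z) = sets (borel :: ('x \<times> 'y) measure)"
    "\<And>z. z \<in> W \<Longrightarrow> distr (Q z) borel fst = M z" "\<And>z. z \<in> W \<Longrightarrow> distr (Q z) borel snd = N z"
    by metis
  from sum_of_measures_exists[of W Q borel, OF Q(1)] obtain \<pi> where
    s: "sets \<pi> = sets borel" and
    \<pi>: "\<And>A. A \<in> sets borel \<Longrightarrow> emeasure \<pi> A = (\<Sum>z\<in>W. emeasure (Q z) A)" by blast
  have \<pi>': "emeasure \<pi> A = (\<Sum>z\<in>W. emeasure (Q z) A)" if "A \<in> sets \<pi>" for A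
    using that \<pi> s by simp
  have Qs: "sets (Q z) = sets \<pi>" if "z \<in> W" for z
    using Q(1)[OF that] s by simp
  have sp: "space \<pi> = UNIV" and spQ: "\<And>z. z \<in> W \<Longrightarrow> space (Q z) = UNIV"
    using s[THEN sets_eq_imp_space_eq] Q(1)[THEN sets_eq_imp_space_eq] by auto
  have vimage: "fst -` A \<in> sets borel" if "A \<in> sets borel" for A :: "'x set"
    using measurable_sets[OF borel_projections(1)[OF refl] that] by simp
  have vimage': "snd -` A \<in> sets borel" if "A \<in> sets borel" for A :: "'y set"
    using measurable_sets[OF borel_projections(2)[OF refl] that] by simp
  have fst: "distr \<pi> borel fst = \<mu>"
  proof (rule measure_eqI)
    fix A assume "A \<in> sets (distr \<pi> borel fst)"
    then have A: "A \<in> sets borel" by simp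
    have "emeasure (distr \<pi> borel fst) A = (\<Sum>z\<in>W. emeasure (Q z) (fst -` A))"
      using emeasure_distr[OF borel_projections(1)[OF s] A] \<pi>[OF vimage[OF A]] sp by simp
    also have "\<dots> = (\<Sum>z\<in>W. emeasure (M z) A)"
      using emeasure_distr[OF borel_projections(1)[OF Q(1)] A] Q(2) spQ
      by (intro sum.cong) auto
    also have "\<dots> = emeasure \<mu> A" using MN A by (auto simp: partitions_def)
    finally show "emeasure (distr \<pi> borel fst) A = emeasure \<mu> A" .
  qed (simp add: sets_mu)
  have snd: "distr \<pi> borel snd = \<nu>"
  proof (rule measure_eqI)
    fix A assume "A \<in> sets (distr \<pi> borel snd)"
    then have A: "A \<in> sets borel" by simp
    have "emeasure (distr \<pi> borel snd) A = (\<Sum>z\<in>W. emeasure (Q z) (snd -` A))"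
      using emeasure_distr[OF borel_projections(2)[OF s] A] \<pi>[OF vimage'[OF A]] sp by simp
    also have "\<dots> = (\<Sum>z\<in>W. emeasure (N z) A)"
      using emeasure_distr[OF borel_projections(2)[OF Q(1)] A] Q(3) spQ
      by (intro sum.cong) auto
    also have "\<dots> = emeasure \<nu> A" using MN A by (auto simp: partitions_def)
    finally show "emeasure (distr \<pi> borel snd) A = emeasure \<nu> A" .
  qed (simp add: sets_nu)
  \<comment> \<open>The total mass is read off from the first marginal.\<close>
  have "prob_space \<pi>"
    using prob_space_distrD[OF borel_projections(1)[OF s]] fst prob_mu by simp
  then have coupling: "\<pi> \<in> couplings \<mu> \<nu>"
    using s fst snd by (simp add: couplings_def)
  have hW: "finite (h ` W)" "h ` W \<noteq> {}" using W by auto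
  note f = min_cost_integrable(1)[OF hW h coupling]
  have "transport_cost c1 c2 (h ` W) \<mu> \<nu> \<le> (\<integral>p. ?f p \<partial>\<pi>)"
    using hW h coupling by (rule transport_cost_le_coupling)
  also have "\<dots> = (\<Sum>z\<in>W. \<integral>p. ?f p \<partial>Q z)"
    using integral_sum_of_measures[OF W(1) Qs \<pi>' f] .
  also have "\<dots> \<le> (\<Sum>z\<in>W. (\<integral>x. c1 x (h z) \<partial>M z) + (\<integral>y. c2 (h z) y \<partial>N z))"
  proof (rule sum_mono)
    fix z assume z: "z \<in> W"
    then have hz: "h z \<in> Z" using h by auto
    note m = borel_projections[OF Q(1)[OF z]]
    note i = partition_integrable[OF W(1) MN z hz]
    have int: "integrable (Q z) (\<lambda>p. c1 (fst p) (h z))" "integrable (Q z) (\<lambda>p. c2 (h z) (snd p))"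
      using i integrable_distr[OF m(1)] integrable_distr[OF m(2)]
      unfolding Q(2,3)[OF z, symmetric] by blast+
    have "integrable (Q z) ?f"
      using integrable_sum_of_measures_iff[OF W(1) Qs \<pi>', of ?f] f z by auto
    \<comment> \<open>The minimum is at most the cost through the admissible point
      \<open>h z\<close>.\<close>
    then have "(\<integral>p. ?f p \<partial>Q z) \<le> (\<integral>p. c1 (fst p) (h z) + c2 (h z) (snd p) \<partial>Q z)"
      using int z W by (intro integral_mono min_cost_le) auto
    also have "\<dots> = (\<integral>x. c1 x (h z) \<partial>M z) + (\<integral>y. c2 (h z) y \<partial>N z)"
      using int integral_distr[OF m(1) c1_borel[OF hz]] integral_distr[OF m(2) c2_borel[OF hz]]
        Q(2,3)[OF z] by simp
    finally show "(\<integral>p. ?f p \<partial>Q z) \<le> (\<integral>x. c1 x (h z) \<partial>M z) + (\<integral>y. c2 (h z) y \<partial>N z)" .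
  qed
  finally show ?thesis .
qed

text \<open>The restrictions \<open>Q z\<close> of \<open>\<pi>\<close> to disjoint cells
  \<open>D z\<close> covering the product add up to \<open>\<pi>\<close>. On \<open>D z\<close> the
  minimum equals the cost through \<open>z\<close>, so the costs agree exactly.\<close>

lemma partition_of_coupling:
  assumes W: "finite W" "W \<noteq> {}" "W \<subseteq> Z" and \<pi>: "\<pi> \<in> couplings \<mu> \<nu>"
  shows "\<exists>P\<in>partitions W \<mu> \<nu>.
    partition_cost c1 c2 W P = (\<integral>p. min_cost c1 c2 W (fst p) (snd p) \<partial>\<pi>)"
proof -
  let ?f = "\<lambda>p. min_cost c1 c2 W (fst p) (snd p)"
  let ?g = "\<lambda>z p. c1 (fst p) z + c2 z (snd p)"
  \<comment> \<open>The points carry no order, so an injection into \<open>nat\<close> supplies one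
    on \<open>W\<close>.\<close>
  obtain e :: "'z \<Rightarrow> nat" where e: "inj_on e W"
    using finite_imp_inj_to_nat_seg[OF W(1)] by blast
  \<comment> \<open>The cell where \<open>z\<close> attains the minimum, ties being broken by the enumeration \<open>e\<close>.\<close>
  define D where "D z = {p. ?g z p = ?f p \<and> (\<forall>w\<in>W. e w < e z \<longrightarrow> ?g w p \<noteq> ?f p)}" for z
  from \<pi> have s: "sets \<pi> = sets borel" and marg: "distr \<pi> borel fst = \<mu>" "distr \<pi> borel snd = \<nu>"
    by (auto simp: couplings_def)
  have sp: "space \<pi> = UNIV" using s[THEN sets_eq_imp_space_eq] by simp
  have fm: "?f \<in> borel_measurable \<pi>"
    using min_cost_integrable(1)[OF W \<pi>] by auto
  have gm: "?g z \<in> borel_measurable \<pi>" if "z \<in> W" for z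
    using coupling_integrable(1,2)[OF \<pi>, of z] that W(3) by (intro borel_measurable_add) auto
  have Dm: "D z \<in> sets \<pi>" if "z \<in> W" for z
  proof -
    have "{p \<in> space \<pi>. ?g z p = ?f p \<and> (\<forall>w\<in>W. e w < e z \<longrightarrow> ?g w p \<noteq> ?f p)} \<in> sets \<pi>"
      using fm gm that W(1)
      by (intro sets.sets_Collect_conj sets.sets_Collect_finite_All' sets.sets_Collect_imp
          sets.sets_Collect_neg borel_measurable_eq sets.sets_Collect_const) (use W in auto)
    then show ?thesis by (simp add: D_def sp)
  qed
  have D_ex1: "\<exists>!z. z \<in> W \<and> p \<in> D z" for p
  proof -
    \<comment> \<open>Among the finitely many points attaining the minimum at \<open>p\<close>, the
      first one in the enumeration is the point whose cell contains \<open>p\<close>.\<close>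
    define z where "z = arg_min_on e {z \<in> W. ?g z p = ?f p}"
    have ne: "{z \<in> W. ?g z p = ?f p} \<noteq> {}"
      by (rule min_cost_attained[OF W(1,2), of c1 c2 "fst p" "snd p"]) auto
    have "z \<in> {z \<in> W. ?g z p = ?f p}" "\<not> (\<exists>w\<in>{z \<in> W. ?g z p = ?f p}. e w < e z)"
      using arg_min_if_finite[OF _ ne] W(1) by (simp_all add: z_def)
    then have "z \<in> W \<and> p \<in> D z" by (auto simp: D_def)
    \<comment> \<open>If two points had \<open>p\<close> in their cells, the one with smaller index
      would attain the minimum, which the cell of the other excludes.\<close>
    moreover have "w = z" if "w \<in> W \<and> p \<in> D w" "z \<in> W \<and> p \<in> D z" for w z
      using that e by (auto simp: D_def inj_on_def) (metis linorder_neqE_nat)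
    ultimately show ?thesis by blast
  qed
  define Q where "Q z = density \<pi> (indicator (D z))" for z
  have Qs: "sets (Q z) = sets \<pi>" for z by (simp add: Q_def)
  have QA: "emeasure (Q z) A = emeasure \<pi> (D z \<inter> A)" if "z \<in> W" "A \<in> sets \<pi>" for z A
    using Dm[OF that(1)] that(2)
    by (simp add: Q_def emeasure_density nn_integral_indicator flip: indicator_inter_arith)
  have Qsum: "emeasure \<pi> A = (\<Sum>z\<in>W. emeasure (Q z) A)" if A: "A \<in> sets \<pi>" for A
  proof -
    have "disjoint_family_on (\<lambda>z. D z \<inter> A) W"
      using D_ex1 by (fastforce simp: disjoint_family_on_def)
    then have "(\<Sum>z\<in>W. emeasure \<pi> (D z \<inter> A)) = emeasure \<pi> (\<Union>z\<in>W. D z \<inter> A)"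
      using W(1) A Dm by (intro sum_emeasure) auto
    also have "(\<Union>z\<in>W. D z \<inter> A) = A" using D_ex1 by blast
    finally show ?thesis using QA A by simp
  qed
  define M where "M z = distr (Q z) borel fst" for z
  define N where "N z = distr (Q z) borel snd" for z
  have Qb: "sets (Q z) = sets borel" for z using Qs s by simp
  have spQ: "space (Q z) = UNIV" for z using Qb[THEN sets_eq_imp_space_eq] by simp
  have fst_vimage: "fst -` A \<in> sets \<pi>" if "A \<in> sets borel" for A
    using measurable_sets[OF borel_projections(1)[OF s] that] sp by simp
  have snd_vimage: "snd -` B \<in> sets \<pi>" if "B \<in> sets borel" for B
    using measurable_sets[OF borel_projections(2)[OF s] that] sp by simp
  have M: "emeasure (M z) A = emeasure (Q z) (fst -` A)" if "A \<in> sets borel" for z A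
    using emeasure_distr[OF borel_projections(1)[OF Qb] that] by (simp add: M_def spQ)
  have N: "emeasure (N z) A = emeasure (Q z) (snd -` A)" if "A \<in> sets borel" for z A
    using emeasure_distr[OF borel_projections(2)[OF Qb] that] by (simp add: N_def spQ)
  have "(\<Sum>z\<in>W. emeasure (M z) A) = emeasure \<mu> A" if "A \<in> sets borel" for A
    using emeasure_distr[OF borel_projections(1)[OF s] that] marg(1) Qsum[OF fst_vimage[OF that]]
      M[OF that] sp by simp
  moreover have "(\<Sum>z\<in>W. emeasure (N z) A) = emeasure \<nu> A" if "A \<in> sets borel" for A
    using emeasure_distr[OF borel_projections(2)[OF s] that] marg(2) Qsum[OF snd_vimage[OF that]]
      N[OF that] sp by simp
  \<comment> \<open>The masses of \<open>M z\<close> and \<open>N z\<close> agree because both equal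
    the mass of \<open>Q z\<close>.\<close>
  ultimately have part: "(M, N) \<in> partitions W \<mu> \<nu>"
    using M[of UNIV] N[of UNIV] by (auto simp: partitions_def M_def N_def)
  have "(\<integral>x. c1 x z \<partial>M z) + (\<integral>y. c2 z y \<partial>N z) = (\<integral>p. ?f p \<partial>Q z)" if z: "z \<in> W" for z
  proof -
    have zZ: "z \<in> Z" using z W(3) by auto
    note m = borel_projections[OF Qb[of z]]
    have int: "integrable (Q z) (\<lambda>p. c1 (fst p) z)" "integrable (Q z) (\<lambda>p. c2 z (snd p))"
      using coupling_integrable(1,2)[OF \<pi> zZ] integrable_sum_of_measures_iff[OF W(1) Qs Qsum] z
      by blast+
    have "(\<integral>x. c1 x z \<partial>M z) + (\<integral>y. c2 z y \<partial>N z) = (\<integral>p. ?g z p \<partial>Q z)"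
      using int integral_distr[OF m(1) c1_borel[OF zZ]] integral_distr[OF m(2) c2_borel[OF zZ]]
      by (simp add: M_def N_def)
    also have "\<dots> = (\<integral>p. ?f p \<partial>Q z)"
    \<comment> \<open>The integrands may differ off \<open>D z\<close>, where the density of
      \<open>Q z\<close> vanishes.\<close>
    proof (rule integral_cong_AE)
      show "AE p in Q z. ?g z p = ?f p"
        unfolding Q_def AE_density[OF borel_measurable_indicator[OF Dm[OF z]]]
        by (intro AE_I2) (auto simp: D_def indicator_def split: if_splits)
    qed (use fm gm[OF z] in \<open>auto simp: Q_def\<close>)
    finally show ?thesis .
  qed
  then have "partition_cost c1 c2 W (M, N) = (\<Sum>z\<in>W. \<integral>p. ?f p \<partial>Q z)"
    by (simp add: partition_cost_def)
  also have "\<dots> = (\<integral>p. ?f p \<partial>\<pi>)"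
    using integral_sum_of_measures[OF W(1) Qs Qsum min_cost_integrable(1)[OF W \<pi>]] by simp
  finally show ?thesis using part by blast
qed

text \<open>Each coupling yields a partition of the same cost, so the optimal cost is a lower bound
  for all the integrals and hence for their infimum.\<close>

lemma optimal_partition_cost_le:
  assumes W: "finite W" "W \<noteq> {}" "W \<subseteq> Z" and P: "optimal_partition c1 c2 W \<mu> \<nu> P"
  shows "partition_cost c1 c2 W P \<le> transport_cost c1 c2 W \<mu> \<nu>"
  unfolding transport_cost_def
proof (rule cINF_greatest[OF couplings_nonempty])
  fix \<pi> assume "\<pi> \<in> couplings \<mu> \<nu>"
  from partition_of_coupling[OF W this] P
  show "partition_cost c1 c2 W P \<le> (\<integral>p. min_cost c1 c2 W (fst p) (snd p) \<partial>\<pi>)"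
    by (force simp: optimal_partition_def is_arg_min_linorder)
qed

end


section \<open>Comparison of the old and the new points\<close>

theorem proposition5p1:
  fixes \<mu> :: "'x::polish_space measure" and \<nu> :: "'y::polish_space measure"
    and Z :: "'z set"
    and c1 :: "'x \<Rightarrow> 'z \<Rightarrow> real" and c2 :: "'z \<Rightarrow> 'y \<Rightarrow> real"
    and m :: nat and zs :: "nat \<Rightarrow> 'z" and \<zeta> :: "nat \<Rightarrow> 'z"
    and M :: "'z \<Rightarrow> 'x measure" and N :: "'z \<Rightarrow> 'y measure"
  assumes "prob_space \<mu>" and "sets \<mu> = sets borel"
    and "prob_space \<nu>" and "sets \<nu> = sets borel"
    and "\<And>z. z \<in> Z \<Longrightarrow> (\<lambda>x. c1 x z) \<in> borel_measurable borel"
    and "\<And>z. z \<in> Z \<Longrightarrow> integrable \<mu> (\<lambda>x. c1 x z)"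
    and "\<And>z. z \<in> Z \<Longrightarrow> (\<lambda>y. c2 z y) \<in> borel_measurable borel"
    and "\<And>z. z \<in> Z \<Longrightarrow> integrable \<nu> (\<lambda>y. c2 z y)"
    and "m \<ge> 1" and "inj_on zs {1..m}" and "zs ` {1..m} \<subseteq> Z"
    and "optimal_partition c1 c2 (zs ` {1..m}) \<mu> \<nu> (M, N)"
    and "\<And>i. i \<in> {1..m} \<Longrightarrow>
           is_arg_min (\<lambda>w. (\<integral>x. c1 x w \<partial>M (zs i)) + (\<integral>y. c2 w y \<partial>N (zs i)))
             (\<lambda>w. w \<in> Z) (\<zeta> i)"
  shows "transport_cost c1 c2 (\<zeta> ` {1..m}) \<mu> \<nu> \<le> transport_cost c1 c2 (zs ` {1..m}) \<mu> \<nu>"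
proof -
  interpret transport_problem \<mu> \<nu> Z c1 c2
    using assms(1-8) by (rule transport_problem.intro)
  let ?W = "zs ` {1..m}"
  \<comment> \<open>The pieces are indexed by points but \<open>\<zeta>\<close> by numbers;
    injectivity of \<open>zs\<close> allows the passage from \<open>zs i\<close> back to
    \<open>i\<close>.\<close>
  let ?h = "\<lambda>z. \<zeta> (the_inv_into {1..m} zs z)"
  have h: "?h (zs i) = \<zeta> i" if "i \<in> {1..m}" for i
    using that assms(10) by (simp add: the_inv_into_f_f)
  have W: "finite ?W" "?W \<noteq> {}" "?W \<subseteq> Z" using assms(9,11) by auto
  have MN: "(M, N) \<in> partitions ?W \<mu> \<nu>"
    using assms(12) by (simp add: optimal_partition_def is_arg_min_def)
  have image: "?h ` ?W = \<zeta> ` {1..m}"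
    unfolding image_image using h by (intro image_cong) auto
  have "\<zeta> i \<in> Z" if "i \<in> {1..m}" for i
    using assms(13)[OF that] by (simp add: is_arg_min_def)
  then have "?h ` ?W \<subseteq> Z" unfolding image by auto
  from transport_cost_le_partition[OF W(1,2) MN this]
  have "transport_cost c1 c2 (\<zeta> ` {1..m}) \<mu> \<nu>
      \<le> (\<Sum>z\<in>?W. (\<integral>x. c1 x (?h z) \<partial>M z) + (\<integral>y. c2 (?h z) y \<partial>N z))"
    unfolding image .
  also have "\<dots> \<le> (\<Sum>z\<in>?W. (\<integral>x. c1 x z \<partial>M z) + (\<integral>y. c2 z y \<partial>N z))"
  proof (rule sum_mono)
    fix z assume "z \<in> ?W"
    then obtain i where i: "i \<in> {1..m}" "z = zs i" by auto
    \<comment> \<open>The old point \<open>zs i\<close> is itself a competitor in the minimisation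
      that defines \<open>\<zeta> i\<close>.\<close>
    then have "zs i \<in> Z" using assms(11) by auto
    with i show "(\<integral>x. c1 x (?h z) \<partial>M z) + (\<integral>y. c2 (?h z) y \<partial>N z)
        \<le> (\<integral>x. c1 x z \<partial>M z) + (\<integral>y. c2 z y \<partial>N z)"
      using assms(13)[OF i(1)] h[OF i(1)] by (auto simp: is_arg_min_linorder)
  qed
  also have "\<dots> = partition_cost c1 c2 ?W (M, N)" by (simp add: partition_cost_def)
  also have "\<dots> \<le> transport_cost c1 c2 ?W \<mu> \<nu>"
    using W assms(12) by (rule optimal_partition_cost_le)
  finally show ?thesis .
qed

end
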